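(* Let $(J,H)$ be a semitoric system on a 4-dimensional symplectic manifold, and let $\Lambda$ be a Liouville torus. Let $I$ be semitoric action variables near $\Lambda$. Let $w(\Lambda)\in\mathbb{R}/\mathbb{Z}$ be the semitoric rotation number of $\Lambda$ and let $w_I(\Lambda)$ be the rotation number relative to $I$, written as a ratio. Then $$w(\Lambda)=\big(w_I(\Lambda)\bmod\mathbb{Z}\big).$$
   Context: An integrable system $F=(J,H)$ on a 4-dimensional symplectic manifold $M$ ($\{J,H\}=0$, $dJ,dH$ almost everywhere independent) is called semitoric if $F:M\to\mathbb{R}^2$ is proper and $J$ is a momentum map for an effective Hamiltonian $\mathbb{S}^1$-action on $M$ (the flow $\varphi_J^t$ of $J$ is $2\pi$-periodic). A Liouville torus is a connected component of $F^{-1}(c)$ with $c$ a regular value of $F$. Action variables near $\Lambda$: functions $I=(I_1,I_2)$ that are part of symplectic coordinates $(I,\theta)\in\mathbb{R}^2\times(\mathbb{R}/2\pi\mathbb{Z})^2$ near $\Lambda$ (symplectic form $dI_1\wedge d\theta_1+dI_2\wedge d\theta_2$) with $F=G(I)$, $G$ a local diffeomorphism; they are oriented if $\det dG>0$. Semitoric action variables are oriented action variables of the form $I=(J,I_2)$. Writing $H=g(I_1,I_2)$, the rotation number relative to $I$ (as a ratio) is $w_I(\Lambda)=\partial_1g(I(\Lambda))/\partial_2g(I(\Lambda))\in\mathbb{R}\cup\{\infty\}$; for semitoric action variables it is a real number. Semitoric rotation number: take $A\in\Lambda$, let $\mathbb{S}^1_A$ be the orbit of $A$ under the flow of $J$,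 and let $A'$ be the first return point on $\mathbb{S}^1_A$ of the trajectory of the Hamiltonian flow of $H$ starting from $A$. Then $w(\Lambda)\in\mathbb{R}/\mathbb{Z}$ is defined by $\varphi_J^{2\pi w(\Lambda)}(A)=A'$. *)

theory Defs
  imports "HOL-Analysis.Analysis" "HOL-Library.Real_Mod"
begin

subsection \<open>Reals modulo \<open>2\<pi>\<close> and modulo 1\<close>

quotient_type angle = real / "\<lambda>x y. [x = y] (rmod (2 * pi))"
  morphisms rep_angle angle_of
  by (intro equivpI reflpI sympI transpI) (auto simp: rcong_def)

quotient_type real_mod_Z = real / "\<lambda>x y. [x = y] (rmod 1)"
  morphisms rep_mod_Z mod_Z
  by (intro equivpI reflpI sympI transpI) (auto simp: rcong_def)


subsection \<open>Smooth maps between open subsets of Euclidean spaces\<close>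

text \<open>All notions below are only meant for open \<open>S\<close>.\<close>

fun Ck_on :: "nat \<Rightarrow> 'e::euclidean_space set \<Rightarrow> ('e \<Rightarrow> 'f::euclidean_space) \<Rightarrow> bool" where
  "Ck_on 0 S f \<longleftrightarrow> continuous_on S f"
| "Ck_on (Suc k) S f \<longleftrightarrow>
     (\<forall>x\<in>S. f differentiable (at x)) \<and> (\<forall>v. Ck_on k S (\<lambda>x. frechet_derivative f (at x) v))"

definition smooth_on :: "'e::euclidean_space set \<Rightarrow> ('e \<Rightarrow> 'f::euclidean_space) \<Rightarrow> bool" where
  "smooth_on S f \<longleftrightarrow> (\<forall>k. Ck_on k S f)"

definition diffeo_on :: "'e::euclidean_space set \<Rightarrow> ('e \<Rightarrow> 'f::euclidean_space) \<Rightarrow> bool" where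
  "diffeo_on V f \<longleftrightarrow> open V \<and> open (f ` V) \<and> inj_on f V \<and> smooth_on V f \<and>
     smooth_on (f ` V) (inv_into V f)"

definition local_diffeo_on :: "'e::euclidean_space set \<Rightarrow> ('e \<Rightarrow> 'f::euclidean_space) \<Rightarrow> bool" where
  "local_diffeo_on D f \<longleftrightarrow> (\<forall>x\<in>D. \<exists>V. x \<in> V \<and> V \<subseteq> D \<and> diffeo_on V f)"

text \<open>Partial derivatives \<open>\<partial>\<^sub>k g\<close> of a function of two variables.\<close>

definition partial :: "2 \<Rightarrow> (real^2 \<Rightarrow> real) \<Rightarrow> real^2 \<Rightarrow> real" where
  "partial k g y = frechet_derivative g (at y) (axis k 1)"


subsection \<open>Symplectic manifolds of dimension 4\<close>

text \<open>
  A chart is a pair of a domain and a coordinate map (only relevant on that domain).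
  A differential 2-form is the family of its local expressions: \<open>form M c x u v\<close> is the value, at the
  point with coordinates \<open>x\<close> in the chart \<open>c\<close>, on the tangent vectors with components \<open>u\<close>, \<open>v\<close>.
\<close>

type_synonym 'a chart = "'a set \<times> ('a \<Rightarrow> real^4)"

record 'a manifold_with_form =
  carrier_top :: "'a topology"
  atlas :: "'a chart set"
  form :: "'a chart \<Rightarrow> real^4 \<Rightarrow> real^4 \<Rightarrow> real^4 \<Rightarrow> real"

abbreviation points :: "'a manifold_with_form \<Rightarrow> 'a set" where
  "points M \<equiv> topspace (carrier_top M)"

text \<open>A map on the manifold read in the chart \<open>(U, \<phi>)\<close>, i.e. \<open>f \<circ> \<phi>\<^sup>-\<^sup>1\<close>.\<close>

definition in_chart :: "'a set \<times> ('a \<Rightarrow> 'e) \<Rightarrow> ('a \<Rightarrow> 'b) \<Rightarrow> 'e \<Rightarrow> 'b" where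
  "in_chart c f = f \<circ> inv_into (fst c) (snd c)"

text \<open>
  \<open>\<kappa>\<close> is a smooth coordinate system on \<open>W\<close>, with values in an arbitrary Euclidean space (later both
  \<open>real^4\<close> and \<open>real^2 \<times> real^2\<close>): a homeomorphism onto an open set, with smooth changes of coordinates,
  in both directions, with all charts of the atlas.
\<close>

definition smooth_chart ::
    "'a manifold_with_form \<Rightarrow> 'a set \<Rightarrow> ('a \<Rightarrow> 'e::euclidean_space) \<Rightarrow> bool" where
  "smooth_chart M W \<kappa> \<longleftrightarrow>
     openin (carrier_top M) W \<and> open (\<kappa> ` W) \<and>
     homeomorphic_map (subtopology (carrier_top M) W) (top_of_set (\<kappa> ` W)) \<kappa> \<and>
     (\<forall>(U, \<phi>)\<in>atlas M.
        smooth_on (\<phi> ` (W \<inter> U)) (in_chart (U, \<phi>) \<kappa>) \<and>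
        smooth_on (\<kappa> ` (W \<inter> U)) (in_chart (W, \<kappa>) \<phi>))"

definition smooth_manifold :: "'a manifold_with_form \<Rightarrow> bool" where
  "smooth_manifold M \<longleftrightarrow>
     Hausdorff_space (carrier_top M) \<and> second_countable (carrier_top M) \<and>
     (\<forall>(U, \<phi>)\<in>atlas M. smooth_chart M U \<phi>) \<and>
     (\<Union>(U, \<phi>)\<in>atlas M. U) = points M"

text \<open>
  The form of \<open>M\<close> has the local expression \<open>\<beta>\<close> in the coordinates \<open>\<kappa>\<close> on \<open>W\<close>: it is the pullback of
  \<open>\<beta>\<close> under the change of coordinates from any chart of the atlas to \<open>\<kappa>\<close>.
\<close>

definition form_expressed_by ::
    "'a manifold_with_form \<Rightarrow> 'a set \<Rightarrow> ('a \<Rightarrow> 'e::euclidean_space) \<Rightarrow> ('e \<Rightarrow> 'e \<Rightarrow> 'e \<Rightarrow> real) \<Rightarrow> bool" where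
  "form_expressed_by M W \<kappa> \<beta> \<longleftrightarrow>
     (\<forall>(U, \<phi>)\<in>atlas M. \<forall>p\<in>W \<inter> U. \<forall>u v.
        form M (U, \<phi>) (\<phi> p) u v =
        \<beta> (\<kappa> p) (frechet_derivative (in_chart (U, \<phi>) \<kappa>) (at (\<phi> p)) u)
               (frechet_derivative (in_chart (U, \<phi>) \<kappa>) (at (\<phi> p)) v))"

definition symplectic_manifold :: "'a manifold_with_form \<Rightarrow> bool" where
  "symplectic_manifold M \<longleftrightarrow>
     smooth_manifold M \<and>
     (\<forall>c\<in>atlas M.
        form_expressed_by M (fst c) (snd c) (form M c) \<and>
        (\<forall>u v. smooth_on (snd c ` fst c) (\<lambda>x. form M c x u v)) \<and>
        (\<forall>x\<in>snd c ` fst c.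
           bilinear (form M c x) \<and>
           (\<forall>u. form M c x u u = 0) \<and>
           (\<forall>u. u \<noteq> 0 \<longrightarrow> (\<exists>v. form M c x u v \<noteq> 0)) \<and>
           \<comment> \<open>closedness, \<open>d\<omega> = 0\<close>, on constant vector fields\<close>
           (\<forall>u v w. frechet_derivative (\<lambda>x. form M c x v w) (at x) u
                  + frechet_derivative (\<lambda>x. form M c x w u) (at x) v
                  + frechet_derivative (\<lambda>x. form M c x u v) (at x) w = 0)))"


subsection \<open>Hamiltonian vector fields and flows\<close>

definition smooth_function :: "'a manifold_with_form \<Rightarrow> ('a \<Rightarrow> real) \<Rightarrow> bool" where
  "smooth_function M f \<longleftrightarrow> (\<forall>c\<in>atlas M. smooth_on (snd c ` fst c) (in_chart c f))"

text \<open>Components, in the chart \<open>c\<close>, of the differential of \<open>f\<close> at \<open>p\<close> and of the Hamiltonian vector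
  field of \<open>f\<close> at \<open>p\<close>. The sign convention \<open>\<omega>(X\<^sub>f, \<cdot>) = -df\<close> is the one for which
  \<open>\<omega> = dI\<^sub>1 \<and> d\<theta>\<^sub>1 + dI\<^sub>2 \<and> d\<theta>\<^sub>2\<close> gives \<open>d\<theta>/dt = \<partial>f/\<partial>I\<close>, \<open>dI/dt = -\<partial>f/\<partial>\<theta>\<close>.\<close>

definition differential :: "'a chart \<Rightarrow> ('a \<Rightarrow> real) \<Rightarrow> 'a \<Rightarrow> real^4 \<Rightarrow> real" where
  "differential c f p = frechet_derivative (in_chart c f) (at (snd c p))"

definition hamiltonian_vector ::
    "'a manifold_with_form \<Rightarrow> 'a chart \<Rightarrow> ('a \<Rightarrow> real) \<Rightarrow> 'a \<Rightarrow> real^4" where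
  "hamiltonian_vector M c f p = (THE u. \<forall>v. form M c (snd c p) u v = - differential c f p v)"

definition integral_curve :: "'a manifold_with_form \<Rightarrow> ('a \<Rightarrow> real) \<Rightarrow> (real \<Rightarrow> 'a) \<Rightarrow> bool" where
  "integral_curve M f \<gamma> \<longleftrightarrow>
     continuous_map euclideanreal (carrier_top M) \<gamma> \<and>
     (\<forall>t. \<forall>c\<in>atlas M. \<gamma> t \<in> fst c \<longrightarrow>
        ((snd c \<circ> \<gamma>) has_vector_derivative hamiltonian_vector M c f (\<gamma> t)) (at t))"

text \<open>\<open>ham_flow M f t A\<close> is \<open>\<phi>\<^sub>f\<^sup>t(A)\<close>; meaningful where the flow is complete.\<close>

definition ham_flow :: "'a manifold_with_form \<Rightarrow> ('a \<Rightarrow> real) \<Rightarrow> real \<Rightarrow> 'a \<Rightarrow> 'a" where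
  "ham_flow M f t A = (THE \<gamma>. integral_curve M f \<gamma> \<and> \<gamma> 0 = A) t"


subsection \<open>Semitoric systems\<close>

definition poisson_commute :: "'a manifold_with_form \<Rightarrow> ('a \<Rightarrow> real) \<Rightarrow> ('a \<Rightarrow> real) \<Rightarrow> bool" where
  "poisson_commute M f g \<longleftrightarrow>
     (\<forall>c\<in>atlas M. \<forall>p\<in>fst c.
        form M c (snd c p) (hamiltonian_vector M c f p) (hamiltonian_vector M c g p) = 0)"

definition independent_differentials_at ::
    "'a manifold_with_form \<Rightarrow> ('a \<Rightarrow> real) \<Rightarrow> ('a \<Rightarrow> real) \<Rightarrow> 'a \<Rightarrow> bool" where
  "independent_differentials_at M f g p \<longleftrightarrow>
     (\<forall>c\<in>atlas M. p \<in> fst c \<longrightarrow>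
        (\<forall>a b. (\<forall>v. a * differential c f p v + b * differential c g p v = 0) \<longrightarrow> a = 0 \<and> b = 0))"

definition integrable_system :: "'a manifold_with_form \<Rightarrow> ('a \<Rightarrow> real) \<Rightarrow> ('a \<Rightarrow> real) \<Rightarrow> bool" where
  "integrable_system M J H \<longleftrightarrow>
     smooth_function M J \<and> smooth_function M H \<and> poisson_commute M J H \<and>
     (\<forall>c\<in>atlas M. negligible (snd c ` {p \<in> fst c. \<not> independent_differentials_at M J H p}))"

text \<open>An action of the circle \<open>\<real>/2\<pi>\<int>\<close>, given as a \<open>2\<pi>\<close>-periodic action of the additive group of reals.\<close>

definition smooth_circle_action :: "'a manifold_with_form \<Rightarrow> (real \<Rightarrow> 'a \<Rightarrow> 'a) \<Rightarrow> bool" where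
  "smooth_circle_action M \<rho> \<longleftrightarrow>
     (\<forall>p\<in>points M. \<rho> 0 p = p \<and> (\<forall>s t. \<rho> (s + t) p = \<rho> s (\<rho> t p)) \<and> (\<forall>t. \<rho> (t + 2 * pi) p = \<rho> t p)) \<and>
     continuous_map (prod_topology euclideanreal (carrier_top M)) (carrier_top M) (\<lambda>(t, p). \<rho> t p) \<and>
     (\<forall>(U, \<phi>)\<in>atlas M. \<forall>(V, \<psi>)\<in>atlas M.
        smooth_on {(t, x). x \<in> \<phi> ` U \<and> \<rho> t (inv_into U \<phi> x) \<in> V}
          (\<lambda>(t, x). \<psi> (\<rho> t (inv_into U \<phi> x))))"

definition effective_circle_action :: "'a manifold_with_form \<Rightarrow> (real \<Rightarrow> 'a \<Rightarrow> 'a) \<Rightarrow> bool" where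
  "effective_circle_action M \<rho> \<longleftrightarrow>
     smooth_circle_action M \<rho> \<and> (\<forall>t. (\<forall>p\<in>points M. \<rho> t p = p) \<longrightarrow> [t = 0] (rmod (2 * pi)))"

definition momentum_map_of_action ::
    "'a manifold_with_form \<Rightarrow> ('a \<Rightarrow> real) \<Rightarrow> (real \<Rightarrow> 'a \<Rightarrow> 'a) \<Rightarrow> bool" where
  "momentum_map_of_action M J \<rho> \<longleftrightarrow> (\<forall>p\<in>points M. integral_curve M J (\<lambda>t. \<rho> t p))"

definition joint_map :: "('a \<Rightarrow> real) \<Rightarrow> ('a \<Rightarrow> real) \<Rightarrow> 'a \<Rightarrow> real^2" where
  "joint_map J H p = vector [J p, H p]"

definition semitoric_system :: "'a manifold_with_form \<Rightarrow> ('a \<Rightarrow> real) \<Rightarrow> ('a \<Rightarrow> real) \<Rightarrow> bool" where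
  "semitoric_system M J H \<longleftrightarrow>
     integrable_system M J H \<and>
     proper_map (carrier_top M) euclidean (joint_map J H) \<and>
     (\<exists>\<rho>. effective_circle_action M \<rho> \<and> momentum_map_of_action M J \<rho>)"

definition fibre :: "'a manifold_with_form \<Rightarrow> ('a \<Rightarrow> real) \<Rightarrow> ('a \<Rightarrow> real) \<Rightarrow> real^2 \<Rightarrow> 'a set" where
  "fibre M J H c = {p \<in> points M. joint_map J H p = c}"

definition liouville_torus ::
    "'a manifold_with_form \<Rightarrow> ('a \<Rightarrow> real) \<Rightarrow> ('a \<Rightarrow> real) \<Rightarrow> 'a set \<Rightarrow> bool" where
  "liouville_torus M J H \<Lambda> \<longleftrightarrow>
     (\<exists>c. (\<forall>p\<in>fibre M J H c. independent_differentials_at M J H p) \<and>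
          \<Lambda> \<in> connected_components_of (subtopology (carrier_top M) (fibre M J H c)))"


subsection \<open>Action variables\<close>

text \<open>The value of \<open>dI\<^sub>1 \<and> d\<theta>\<^sub>1 + dI\<^sub>2 \<and> d\<theta>\<^sub>2\<close> on two vectors with components \<open>(dI, d\<theta>)\<close>.\<close>

definition standard_form :: "(real^2) \<times> (real^2) \<Rightarrow> (real^2) \<times> (real^2) \<Rightarrow> real" where
  "standard_form u v = fst u \<bullet> snd v - snd u \<bullet> fst v"

text \<open>
  \<open>(I, \<theta>)\<close> are symplectic coordinates from \<open>U\<close> to an open subset of \<open>\<real>\<^sup>2 \<times> (\<real>/2\<pi>\<int>)\<^sup>2\<close>: an injective map which,
  near each point, becomes a symplectic chart when the angles are lifted suitably to real functions.
\<close>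

definition symplectic_angle_coordinates ::
    "'a manifold_with_form \<Rightarrow> 'a set \<Rightarrow> ('a \<Rightarrow> real^2) \<Rightarrow> ('a \<Rightarrow> angle^2) \<Rightarrow> bool" where
  "symplectic_angle_coordinates M U I \<theta> \<longleftrightarrow>
     openin (carrier_top M) U \<and>
     inj_on (\<lambda>p. (I p, \<theta> p)) U \<and>
     (\<forall>p\<in>U. \<exists>W \<theta>'. p \<in> W \<and> W \<subseteq> U \<and>
        (\<forall>q\<in>W. \<theta> q = (\<chi> k. angle_of (\<theta>' q $ k))) \<and>
        smooth_chart M W (\<lambda>q. (I q, \<theta>' q)) \<and>
        form_expressed_by M W (\<lambda>q. (I q, \<theta>' q)) (\<lambda>_. standard_form))"

definition action_variables ::
    "'a manifold_with_form \<Rightarrow> ('a \<Rightarrow> real) \<Rightarrow> ('a \<Rightarrow> real) \<Rightarrow> 'a set \<Rightarrow> 'a set \<Rightarrow>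
     ('a \<Rightarrow> real^2) \<Rightarrow> ('a \<Rightarrow> angle^2) \<Rightarrow> (real^2 \<Rightarrow> real^2) \<Rightarrow> bool" where
  "action_variables M J H \<Lambda> U I \<theta> G \<longleftrightarrow>
     \<Lambda> \<subseteq> U \<and> symplectic_angle_coordinates M U I \<theta> \<and>
     local_diffeo_on (I ` U) G \<and> (\<forall>p\<in>U. joint_map J H p = G (I p))"

definition oriented_action_variables ::
    "'a manifold_with_form \<Rightarrow> ('a \<Rightarrow> real) \<Rightarrow> ('a \<Rightarrow> real) \<Rightarrow> 'a set \<Rightarrow> 'a set \<Rightarrow>
     ('a \<Rightarrow> real^2) \<Rightarrow> ('a \<Rightarrow> angle^2) \<Rightarrow> (real^2 \<Rightarrow> real^2) \<Rightarrow> bool" where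
  "oriented_action_variables M J H \<Lambda> U I \<theta> G \<longleftrightarrow>
     action_variables M J H \<Lambda> U I \<theta> G \<and>
     (\<forall>y\<in>I ` U. det (matrix (frechet_derivative G (at y))) > 0)"

definition semitoric_action_variables ::
    "'a manifold_with_form \<Rightarrow> ('a \<Rightarrow> real) \<Rightarrow> ('a \<Rightarrow> real) \<Rightarrow> 'a set \<Rightarrow> 'a set \<Rightarrow>
     ('a \<Rightarrow> real^2) \<Rightarrow> ('a \<Rightarrow> angle^2) \<Rightarrow> (real^2 \<Rightarrow> real^2) \<Rightarrow> bool" where
  "semitoric_action_variables M J H \<Lambda> U I \<theta> G \<longleftrightarrow>
     oriented_action_variables M J H \<Lambda> U I \<theta> G \<and> (\<forall>p\<in>U. I p $ 1 = J p)"


subsection \<open>Rotation numbers\<close>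

text \<open>
  \<open>\<partial>\<^sub>1 g / \<partial>\<^sub>2 g\<close> at the common value of \<open>I\<close> on \<open>\<Lambda>\<close>, for \<open>H = g(I)\<close>. In general this ratio lies in
  \<open>\<real> \<union> {\<infinity>}\<close>; here it is only used for semitoric action variables, where \<open>\<partial>\<^sub>2 g = det dG > 0\<close>, so that
  the real quotient is the intended one.
\<close>

definition rotation_ratio :: "('a \<Rightarrow> real^2) \<Rightarrow> (real^2 \<Rightarrow> real) \<Rightarrow> 'a set \<Rightarrow> real" where
  "rotation_ratio I g \<Lambda> = (let y = (THE y. I ` \<Lambda> = {y}) in partial 1 g y / partial 2 g y)"

definition circle_orbit :: "'a manifold_with_form \<Rightarrow> ('a \<Rightarrow> real) \<Rightarrow> 'a \<Rightarrow> 'a set" where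
  "circle_orbit M J A = range (\<lambda>s. ham_flow M J s A)"

definition first_return_time ::
    "'a manifold_with_form \<Rightarrow> ('a \<Rightarrow> real) \<Rightarrow> ('a \<Rightarrow> real) \<Rightarrow> 'a \<Rightarrow> real \<Rightarrow> bool" where
  "first_return_time M J H A T \<longleftrightarrow>
     T > 0 \<and> ham_flow M H T A \<in> circle_orbit M J A \<and>
     (\<forall>t. 0 < t \<and> t < T \<longrightarrow> ham_flow M H t A \<notin> circle_orbit M J A)"

text \<open>The class \<open>w \<in> \<real>/\<int>\<close> such that \<open>\<phi>\<^sub>J\<^sup>2\<^sup>\<pi>\<^sup>w(A)\<close> is the first return point of the trajectory of \<open>A\<close>,
  whatever the choice of \<open>A \<in> \<Lambda>\<close>.\<close>

definition semitoric_rotation_number ::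
    "'a manifold_with_form \<Rightarrow> ('a \<Rightarrow> real) \<Rightarrow> ('a \<Rightarrow> real) \<Rightarrow> 'a set \<Rightarrow> real_mod_Z" where
  "semitoric_rotation_number M J H \<Lambda> =
     (THE r. \<forall>A\<in>\<Lambda>. \<exists>T w. first_return_time M J H A T \<and> r = mod_Z w \<and>
        ham_flow M J (2 * pi * w) A = ham_flow M H T A)"

end

theory Submission
  imports Defs
begin

text \<open>
  In action-angle coordinates the form is \<open>dI\<^sub>1 \<and> d\<theta>\<^sub>1 + dI\<^sub>2 \<and> d\<theta>\<^sub>2\<close>, so the Hamiltonian flow of a function
  \<open>h(I)\<close> keeps the actions fixed and moves the angles with the constant velocity \<open>\<nabla>h(I)\<close>. For
  \<open>J = I\<^sub>1\<close> this velocity is \<open>(1, 0)\<close>, for \<open>H = g(I)\<close> it is \<open>(\<partial>\<^sub>1g, \<partial>\<^sub>2g)\<close>. Orientation of the action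
  variables means \<open>\<partial>\<^sub>2g > 0\<close>, since \<open>G = (I\<^sub>1, g)\<close> has Jacobian \<open>\<partial>\<^sub>2g\<close>. A trajectory of \<open>H\<close> therefore first
  returns to the circle \<open>\<theta>\<^sub>2 = const\<close> at time \<open>2\<pi> / \<partial>\<^sub>2g\<close>, when \<open>\<theta>\<^sub>1\<close> has advanced by \<open>2\<pi> \<partial>\<^sub>1g / \<partial>\<^sub>2g\<close>, and
  the rotation number is the class of \<open>\<partial>\<^sub>1g / \<partial>\<^sub>2g\<close> modulo 1.

  Three points need an argument. The actions are constant on \<open>\<Lambda>\<close> because \<open>F = G(I)\<close> is, \<open>G\<close> is locally
  injective and \<open>\<Lambda>\<close> is connected (\<open>action_constant_on_connected\<close>). The linear motion of the angles has
  to be realised by points of \<open>\<Lambda>\<close> for all times, although \<open>U\<close> is an arbitrary neighbourhood of \<open>\<Lambda>\<close>: the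
  angles map \<open>\<Lambda>\<close> onto the whole torus, as their image is open and \<open>\<Lambda>\<close> is compact
  (\<open>angles_surjective\<close>), which gives a covering \<open>torus_point\<close> of \<open>\<Lambda>\<close> by the plane. Finally the flows are
  described as the unique integral curves through a point. Uniqueness holds because in an action-angle
  chart the equation is solved explicitly, and the agreement with the linear curve then propagates
  along the time line by connectedness (\<open>integral_curve_unique\<close>).
\<close>

section \<open>Smooth coordinates\<close>

lemma smooth_on_imp_differentiable:
  assumes "smooth_on S f" "x \<in> S"
  shows "f differentiable (at x)"
proof -
  have "Ck_on (Suc 0) S f" using assms(1) unfolding smooth_on_def by (rule spec)
  with assms(2) show ?thesis by simp
qed

lemma smooth_chart_inj_on:
  assumes "smooth_chart M W \<kappa>"
  shows "inj_on \<kappa> W"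
proof -
  have "W \<subseteq> points M" "inj_on \<kappa> (topspace (subtopology (carrier_top M) W))"
    using assms unfolding smooth_chart_def
    by (auto simp: openin_subset dest: homeomorphic_imp_injective_map)
  then show ?thesis by (simp add: Int_absorb1)
qed

lemma smooth_chart_continuous_map:
  assumes "smooth_chart M W \<kappa>"
  shows "continuous_map (subtopology (carrier_top M) W) euclidean \<kappa>"
proof -
  have "homeomorphic_map (subtopology (carrier_top M) W) (top_of_set (\<kappa> ` W)) \<kappa>"
    using assms unfolding smooth_chart_def by blast
  from homeomorphic_imp_continuous_map[OF this] show ?thesis
    by (rule continuous_map_into_fulltopology)
qed

lemma smooth_chart_open_image:
  assumes "smooth_chart M W \<kappa>" "openin (carrier_top M) N"
  shows "open (\<kappa> ` (W \<inter> N))"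
proof -
  have hom: "homeomorphic_map (subtopology (carrier_top M) W) (top_of_set (\<kappa> ` W)) \<kappa>"
    and op: "open (\<kappa> ` W)"
    using assms unfolding smooth_chart_def by auto
  have "openin (subtopology (carrier_top M) W) (W \<inter> N)"
    using assms(2) by (simp add: openin_subtopology_Int2)
  then have "openin (top_of_set (\<kappa> ` W)) (\<kappa> ` (W \<inter> N))"
    using homeomorphic_map_openness_eq[OF hom] by blast
  with op show ?thesis using openin_open_trans by blast
qed

lemma smooth_chart_continuous_inverse:
  assumes "smooth_chart M W \<kappa>"
  shows "continuous_map (top_of_set (\<kappa> ` W)) (carrier_top M) (inv_into W \<kappa>)"
proof -
  have hom: "homeomorphic_map (subtopology (carrier_top M) W) (top_of_set (\<kappa> ` W)) \<kappa>"
    and W: "openin (carrier_top M) W"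
    using assms unfolding smooth_chart_def by auto
  obtain h where h: "homeomorphic_maps (subtopology (carrier_top M) W) (top_of_set (\<kappa> ` W)) \<kappa> h"
    using hom unfolding homeomorphic_map_maps by blast
  have ts: "topspace (subtopology (carrier_top M) W) = W"
    using openin_subset[OF W] by (simp add: Int_absorb1)
  have "continuous_map (top_of_set (\<kappa> ` W)) (carrier_top M) h"
    using h unfolding homeomorphic_maps_def by (blast intro: continuous_map_into_fulltopology)
  moreover have "h z = inv_into W \<kappa> z" if "z \<in> \<kappa> ` W" for z
    using h that ts smooth_chart_inj_on[OF assms] unfolding homeomorphic_maps_def by auto
  ultimately show ?thesis
    by (rule continuous_map_eq) auto
qed

text \<open>
  The two transition maps between \<open>\<kappa>\<close> and a chart of the atlas are inverse to each other on open
  sets, so the chain rule makes their derivatives inverse linear maps.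
\<close>

lemma transition_derivatives:
  fixes \<kappa> :: "'a \<Rightarrow> 'e::euclidean_space"
  assumes M: "smooth_manifold M" and c: "(V, \<phi>) \<in> atlas M"
    and W: "smooth_chart M W \<kappa>" and p: "p \<in> W" "p \<in> V"
  defines "D \<equiv> frechet_derivative (in_chart (V, \<phi>) \<kappa>) (at (\<phi> p))"
    and "D' \<equiv> frechet_derivative (in_chart (W, \<kappa>) \<phi>) (at (\<kappa> p))"
  shows "(in_chart (V, \<phi>) \<kappa> has_derivative D) (at (\<phi> p))"
    and "(in_chart (W, \<kappa>) \<phi> has_derivative D') (at (\<kappa> p))"
    and "D' (D u) = u" and "D (D' z) = z"
proof -
  have V: "smooth_chart M V \<phi>" using M c unfolding smooth_manifold_def by auto
  have inj: "inj_on \<kappa> W" "inj_on \<phi> V" using V W smooth_chart_inj_on by auto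
  have sm: "smooth_on (\<phi> ` (W \<inter> V)) (in_chart (V, \<phi>) \<kappa>)" "smooth_on (\<kappa> ` (W \<inter> V)) (in_chart (W, \<kappa>) \<phi>)"
    using W c unfolding smooth_chart_def by auto
  have op: "open (\<phi> ` (W \<inter> V))" "open (\<kappa> ` (W \<inter> V))"
    using smooth_chart_open_image[OF V, of W] smooth_chart_open_image[OF W, of V] V W
    unfolding smooth_chart_def by (auto simp: Int_commute)
  show D: "(in_chart (V, \<phi>) \<kappa> has_derivative D) (at (\<phi> p))"
    unfolding D_def using smooth_on_imp_differentiable[OF sm(1)] p
    by (auto simp: frechet_derivative_works[symmetric])
  show D': "(in_chart (W, \<kappa>) \<phi> has_derivative D') (at (\<kappa> p))"
    unfolding D'_def using smooth_on_imp_differentiable[OF sm(2)] p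
    by (auto simp: frechet_derivative_works[symmetric])
  have e: "in_chart (V, \<phi>) \<kappa> (\<phi> p) = \<kappa> p" "in_chart (W, \<kappa>) \<phi> (\<kappa> p) = \<phi> p"
    using p inj by (auto simp: in_chart_def)
  have "((in_chart (W, \<kappa>) \<phi> \<circ> in_chart (V, \<phi>) \<kappa>) has_derivative (D' \<circ> D)) (at (\<phi> p))"
    using D D' by (intro diff_chain_at) (auto simp: e)
  then have "(id has_derivative (D' \<circ> D)) (at (\<phi> p))"
    by (rule has_derivative_transform_within_open[OF _ op(1)])
      (use p inj in \<open>auto simp: in_chart_def\<close>)
  then have "D' \<circ> D = id" using has_derivative_unique[OF _ has_derivative_ident] by (auto simp: id_def)
  then show "D' (D u) = u" by (simp add: fun_eq_iff)
  have "((in_chart (V, \<phi>) \<kappa> \<circ> in_chart (W, \<kappa>) \<phi>) has_derivative (D \<circ> D')) (at (\<kappa> p))"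
    using D D' by (intro diff_chain_at) (auto simp: e)
  then have "(id has_derivative (D \<circ> D')) (at (\<kappa> p))"
    by (rule has_derivative_transform_within_open[OF _ op(2)])
      (use p inj in \<open>auto simp: in_chart_def\<close>)
  then have "D \<circ> D' = id" using has_derivative_unique[OF _ has_derivative_ident] by (auto simp: id_def)
  then show "D (D' z) = z" by (simp add: fun_eq_iff)
qed

lemma continuous_curve_stays:
  assumes "continuous_map euclideanreal X \<gamma>" "openin X N" "\<gamma> t \<in> N"
  obtains \<delta> where "\<delta> > 0" "\<And>s. s \<in> ball t \<delta> \<Longrightarrow> \<gamma> s \<in> N"
proof -
  have "open {s. \<gamma> s \<in> N}"
    using openin_continuous_map_preimage[OF assms(1,2)] by simp
  moreover have "t \<in> {s. \<gamma> s \<in> N}" using assms(3) by simp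
  ultimately obtain d where "d > 0" "ball t d \<subseteq> {s. \<gamma> s \<in> N}"
    by (rule openE)
  then show ?thesis by (intro that[of d]) auto
qed

lemma velocity_under_transition:
  assumes \<gamma>: "continuous_map euclideanreal X \<gamma>" and N: "openin X N" "\<gamma> t \<in> N" "N \<subseteq> V"
    and inj: "inj_on \<alpha> V"
    and v: "((\<alpha> \<circ> \<gamma>) has_vector_derivative x) (at t)"
    and D: "(in_chart (V, \<alpha>) \<beta> has_derivative D) (at (\<alpha> (\<gamma> t)))"
  shows "((\<beta> \<circ> \<gamma>) has_vector_derivative D x) (at t)"
proof -
  obtain \<delta> where \<delta>: "\<delta> > 0" "\<And>s. s \<in> ball t \<delta> \<Longrightarrow> \<gamma> s \<in> N"
    using continuous_curve_stays[OF \<gamma> N(1,2)] by blast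
  have "((in_chart (V, \<alpha>) \<beta> \<circ> (\<alpha> \<circ> \<gamma>)) has_derivative (D \<circ> (\<lambda>h. h *\<^sub>R x))) (at t)"
    using v D unfolding has_vector_derivative_def by (intro diff_chain_at) auto
  then have "((in_chart (V, \<alpha>) \<beta> \<circ> (\<alpha> \<circ> \<gamma>)) has_vector_derivative D x) (at t)"
    using has_derivative_bounded_linear[OF D]
    unfolding has_vector_derivative_def by (simp add: o_def linear_simps)
  then show ?thesis
    by (rule has_vector_derivative_transform_within_open[OF _ open_ball[of t \<delta>]])
      (use \<delta> N(3) inj in \<open>auto simp: in_chart_def subset_eq\<close>)
qed


section \<open>Hamilton's equations in action-angle coordinates\<close>

text \<open>
  The equation \<open>\<omega>(X, \<cdot>) = -df\<close> is transported to the coordinates \<open>\<kappa>\<close>, where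
  \<open>standard_form (0, v) b = - (v \<bullet> fst b)\<close> exhibits \<open>(0, v)\<close> as a solution; non-degeneracy of the
  standard form makes it the only one, as the description operator in
  \<open>hamiltonian_vector\<close> demands.
\<close>

lemma hamiltonian_vector_action_angle:
  fixes \<kappa> :: "'a \<Rightarrow> (real^2) \<times> (real^2)"
  assumes M: "smooth_manifold M" and c: "(V, \<phi>) \<in> atlas M"
    and W: "smooth_chart M W \<kappa>" and \<omega>: "form_expressed_by M W \<kappa> (\<lambda>_. standard_form)"
    and p: "p \<in> W" "p \<in> V"
    and f: "\<And>q. q \<in> W \<Longrightarrow> f q = h (fst (\<kappa> q))"
    and h: "(h has_derivative (\<lambda>y. v \<bullet> y)) (at (fst (\<kappa> p)))"
  shows "hamiltonian_vector M (V, \<phi>) f p = frechet_derivative (in_chart (W, \<kappa>) \<phi>) (at (\<kappa> p)) (0, v)"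
proof -
  define D where "D = frechet_derivative (in_chart (V, \<phi>) \<kappa>) (at (\<phi> p))"
  define D' where "D' = frechet_derivative (in_chart (W, \<kappa>) \<phi>) (at (\<kappa> p))"
  note tr = transition_derivatives[OF M c W p, folded D_def D'_def]
  have V: "smooth_chart M V \<phi>" using M c unfolding smooth_manifold_def by auto
  have inj: "inj_on \<phi> V" by (rule smooth_chart_inj_on[OF V])
  have op: "open (\<phi> ` (V \<inter> W))"
    using smooth_chart_open_image[OF V] W unfolding smooth_chart_def by auto
  have e: "in_chart (V, \<phi>) \<kappa> (\<phi> p) = \<kappa> p" using p inj by (auto simp: in_chart_def)
  have "((\<lambda>x. h (fst (in_chart (V, \<phi>) \<kappa> x))) has_derivative (\<lambda>x. v \<bullet> fst (D x))) (at (\<phi> p))"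
    by (rule has_derivative_compose[OF has_derivative_fst[OF tr(1)], of h]) (use h e in simp)
  then have "(in_chart (V, \<phi>) f has_derivative (\<lambda>x. v \<bullet> fst (D x))) (at (\<phi> p))"
    by (rule has_derivative_transform_within_open[OF _ op])
      (use p inj f in \<open>auto simp: in_chart_def\<close>)
  then have df: "differential (V, \<phi>) f p w = v \<bullet> fst (D w)" for w
    unfolding differential_def by (simp add: frechet_derivative_at[symmetric])
  have form: "form M (V, \<phi>) (\<phi> p) u w = standard_form (D u) (D w)" for u w
    using \<omega> c p unfolding form_expressed_by_def D_def by fastforce
  show ?thesis
    unfolding hamiltonian_vector_def D'_def[symmetric]
  proof (rule the_equality)
    show "\<forall>w. form M (V, \<phi>) (snd (V, \<phi>) p) (D' (0, v)) w = - differential (V, \<phi>) f p w"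
      by (simp add: form df tr standard_form_def inner_commute)
  next
    fix u assume u: "\<forall>w. form M (V, \<phi>) (snd (V, \<phi>) p) u w = - differential (V, \<phi>) f p w"
    have *: "fst (D u) \<bullet> snd b - snd (D u) \<bullet> fst b = - (v \<bullet> fst b)" for b
      using u[rule_format, of "D' b"] by (simp add: form df tr standard_form_def)
    \<comment> \<open>Test vectors that turn each component of \<open>D u - (0, v)\<close> into its own squared norm.\<close>
    have "fst (D u) = 0" using *[of "(0, fst (D u))"] by simp
    moreover have "snd (D u) = v"
    proof -
      have "(v - snd (D u)) \<bullet> (v - snd (D u)) = 0"
        using *[of "(v - snd (D u), 0)"] by (simp add: inner_diff_left inner_diff_right inner_commute)
      then show ?thesis by simp
    qed
    ultimately have "D u = (0, v)" by (simp add: prod_eq_iff)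
    then show "u = D' (0, v)" using tr(3) by metis
  qed
qed

text \<open>
  Hamilton's equations \<open>dI/dt = 0\<close>, \<open>d\<theta>/dt = v\<close>. The equivalence serves both to construct integral
  curves and to constrain given ones: the condition in every chart of the atlas is traded for a single
  explicit equation.
\<close>

lemma integral_curve_action_angle:
  fixes \<kappa> :: "'a \<Rightarrow> (real^2) \<times> (real^2)"
  assumes M: "smooth_manifold M"
    and W: "smooth_chart M W \<kappa>" and \<omega>: "form_expressed_by M W \<kappa> (\<lambda>_. standard_form)"
    and f: "\<And>q. q \<in> W \<Longrightarrow> f q = h (fst (\<kappa> q))"
    and h: "(h has_derivative (\<lambda>y. v \<bullet> y)) (at (fst (\<kappa> (\<gamma> t))))"
    and \<gamma>: "continuous_map euclideanreal (carrier_top M) \<gamma>" and t: "\<gamma> t \<in> W"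
  shows "(\<forall>c\<in>atlas M. \<gamma> t \<in> fst c \<longrightarrow>
            ((snd c \<circ> \<gamma>) has_vector_derivative hamiltonian_vector M c f (\<gamma> t)) (at t)) \<longleftrightarrow>
         ((\<kappa> \<circ> \<gamma>) has_vector_derivative (0, v)) (at t)"
proof -
  have oW: "openin (carrier_top M) W" using W unfolding smooth_chart_def by auto
  have chart: "((\<phi> \<circ> \<gamma>) has_vector_derivative hamiltonian_vector M (V, \<phi>) f (\<gamma> t)) (at t) \<longleftrightarrow>
      ((\<kappa> \<circ> \<gamma>) has_vector_derivative (0, v)) (at t)"
    if c: "(V, \<phi>) \<in> atlas M" and V: "\<gamma> t \<in> V" for V \<phi>
  proof -
    have sV: "smooth_chart M V \<phi>" using M c unfolding smooth_manifold_def by auto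
    have N: "openin (carrier_top M) (W \<inter> V)" "\<gamma> t \<in> W \<inter> V" "W \<inter> V \<subseteq> V" "W \<inter> V \<subseteq> W"
      using oW sV V t unfolding smooth_chart_def by auto
    note tr = transition_derivatives[OF M c W t V]
    note X = hamiltonian_vector_action_angle[where f=f, OF M c W \<omega> t V f h]
    show ?thesis
    proof
      assume "((\<phi> \<circ> \<gamma>) has_vector_derivative hamiltonian_vector M (V, \<phi>) f (\<gamma> t)) (at t)"
      from velocity_under_transition[OF \<gamma> N(1,2,3) smooth_chart_inj_on[OF sV] this tr(1)]
      show "((\<kappa> \<circ> \<gamma>) has_vector_derivative (0, v)) (at t)" by (simp add: X tr(4))
    next
      assume "((\<kappa> \<circ> \<gamma>) has_vector_derivative (0, v)) (at t)"
      from velocity_under_transition[OF \<gamma> N(1,2,4) smooth_chart_inj_on[OF W] this tr(2)]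
      show "((\<phi> \<circ> \<gamma>) has_vector_derivative hamiltonian_vector M (V, \<phi>) f (\<gamma> t)) (at t)"
        by (simp add: X)
    qed
  qed
  have "\<gamma> t \<in> points M" using t oW openin_subset by blast
  then obtain V \<phi> where "(V, \<phi>) \<in> atlas M" "\<gamma> t \<in> V"
    using M unfolding smooth_manifold_def by blast
  with chart show ?thesis by fastforce
qed


section \<open>The torus in angle coordinates\<close>

definition angle_point :: "real^2 \<Rightarrow> angle^2" where
  "angle_point x = (\<chi> k. angle_of (x $ k))"

lemma angle_point_eq_iff:
  "angle_point x = angle_point x' \<longleftrightarrow>
     [x $ 1 = x' $ 1] (rmod (2 * pi)) \<and> [x $ 2 = x' $ 2] (rmod (2 * pi))"
  by (simp add: angle_point_def vec_eq_iff forall_2 angle.abs_eq_iff)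

lemma angle_point_add_cong:
  "angle_point x = angle_point x' \<Longrightarrow> angle_point (x + z) = angle_point (x' + z)"
  by (simp add: angle_point_eq_iff)

lemma symplectic_angle_coordinates_chart:
  assumes "symplectic_angle_coordinates M U I \<theta>" "p \<in> U"
  obtains W \<theta>' where "p \<in> W" "W \<subseteq> U" "\<forall>q\<in>W. \<theta> q = angle_point (\<theta>' q)"
    "smooth_chart M W (\<lambda>q. (I q, \<theta>' q))"
    "form_expressed_by M W (\<lambda>q. (I q, \<theta>' q)) (\<lambda>_. standard_form)"
proof -
  have "\<exists>W \<theta>'. p \<in> W \<and> W \<subseteq> U \<and> (\<forall>q\<in>W. \<theta> q = angle_point (\<theta>' q)) \<and>
      smooth_chart M W (\<lambda>q. (I q, \<theta>' q)) \<and>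
      form_expressed_by M W (\<lambda>q. (I q, \<theta>' q)) (\<lambda>_. standard_form)"
    using assms unfolding symplectic_angle_coordinates_def angle_point_def by simp
  then show ?thesis using that by auto
qed

text \<open>
  The situation near a Liouville torus, stripped of the two integrals: a compact part \<open>\<Lambda>\<close> of a level set
  of the actions that absorbs every connected part of this level set which it meets, as a connected
  component does.
\<close>

locale action_angle_torus =
  fixes M :: "'a manifold_with_form" and U :: "'a set" and I :: "'a \<Rightarrow> real^2"
    and \<theta> :: "'a \<Rightarrow> angle^2" and \<Lambda> :: "'a set" and y :: "real^2"
  assumes manifold: "smooth_manifold M"
    and coordinates: "symplectic_angle_coordinates M U I \<theta>"
    and compact: "compactin (carrier_top M) \<Lambda>"
    and nonempty: "\<Lambda> \<noteq> {}"
    and subset: "\<Lambda> \<subseteq> U"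
    and action: "p \<in> \<Lambda> \<Longrightarrow> I p = y"
    and maximal: "\<lbrakk>connectedin (carrier_top M) S; S \<subseteq> U; \<And>p. p \<in> S \<Longrightarrow> I p = y; S \<inter> \<Lambda> \<noteq> {}\<rbrakk>
      \<Longrightarrow> S \<subseteq> \<Lambda>"
begin

definition canonical_chart :: "'a set \<Rightarrow> ('a \<Rightarrow> real^2) \<Rightarrow> bool" where
  "canonical_chart W \<theta>' \<longleftrightarrow> W \<subseteq> U \<and> (\<forall>q\<in>W. \<theta> q = angle_point (\<theta>' q)) \<and>
     smooth_chart M W (\<lambda>q. (I q, \<theta>' q)) \<and>
     form_expressed_by M W (\<lambda>q. (I q, \<theta>' q)) (\<lambda>_. standard_form)"

lemma canonical_chart_at:
  assumes "p \<in> U"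
  obtains W \<theta>' where "canonical_chart W \<theta>'" "p \<in> W"
proof -
  obtain W \<theta>' where "p \<in> W" "W \<subseteq> U" "\<forall>q\<in>W. \<theta> q = angle_point (\<theta>' q)"
      "smooth_chart M W (\<lambda>q. (I q, \<theta>' q))"
      "form_expressed_by M W (\<lambda>q. (I q, \<theta>' q)) (\<lambda>_. standard_form)"
    by (rule symplectic_angle_coordinates_chart[OF coordinates assms])
  then show ?thesis by (intro that[of W \<theta>']) (auto simp: canonical_chart_def)
qed

lemma angle_eqI:
  assumes "p \<in> U" "q \<in> U" "I p = I q" "\<theta> p = \<theta> q"
  shows "p = q"
  using coordinates assms unfolding symplectic_angle_coordinates_def inj_on_def by blast

text \<open>
  A disc in the slice \<open>I = y\<close> of a chart is a connected part of that level set, so as soon as it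
  meets \<open>\<Lambda>\<close> it lies in \<open>\<Lambda>\<close>. This makes the image of \<open>\<Lambda>\<close> under the angles open.
\<close>

lemma slice_in_torus:
  assumes W: "canonical_chart W \<theta>'" and q: "q \<in> W" "q \<in> \<Lambda>"
    and ball: "ball (y, \<theta>' q) \<epsilon> \<subseteq> (\<lambda>q. (I q, \<theta>' q)) ` W" and z: "norm z < \<epsilon>"
  obtains q' where "q' \<in> W" "q' \<in> \<Lambda>" "\<theta>' q' = \<theta>' q + z"
proof -
  define \<kappa> where "\<kappa> = (\<lambda>q. (I q, \<theta>' q))"
  have sW: "smooth_chart M W \<kappa>" and WU: "W \<subseteq> U"
    using W unfolding canonical_chart_def \<kappa>_def by auto
  define slice where "slice = (\<lambda>t. (y, \<theta>' q + t)) ` ball 0 \<epsilon>"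
  define C where "C = inv_into W \<kappa> ` slice"
  have slice: "slice \<subseteq> \<kappa> ` W"
    using ball unfolding slice_def \<kappa>_def
    by (force simp: dist_Pair_Pair dist_norm)
  have "connected slice"
    unfolding slice_def by (intro connected_continuous_image continuous_intros) simp
  then have "connectedin (top_of_set (\<kappa> ` W)) slice"
    using slice by (simp add: connectedin_subtopology)
  from connectedin_continuous_map_image[OF smooth_chart_continuous_inverse[OF sW] this]
  have "connectedin (carrier_top M) C" unfolding C_def .
  moreover have CW: "C \<subseteq> W" using slice unfolding C_def by (auto intro: inv_into_into)
  moreover have point: "\<exists>q'\<in>C. \<kappa> q' = (y, \<theta>' q + t)" if "norm t < \<epsilon>" for t
  proof -
    have "(y, \<theta>' q + t) \<in> slice" using that unfolding slice_def by auto
    then show ?thesis unfolding C_def using slice by (auto intro!: bexI f_inv_into_f)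
  qed
  moreover have "I p = y" if p: "p \<in> C" for p
  proof -
    obtain t where "t \<in> slice" "p = inv_into W \<kappa> t" using p unfolding C_def by blast
    then have "\<kappa> p = t" using slice by (metis f_inv_into_f subsetD)
    then show ?thesis using \<open>t \<in> slice\<close> unfolding slice_def \<kappa>_def by auto
  qed
  moreover have "q \<in> C"
  proof -
    have "0 < \<epsilon>" using z norm_ge_zero le_less_trans by blast
    then obtain q' where "q' \<in> C" "\<kappa> q' = \<kappa> q"
      using point[of 0] action[OF q(2)] by (auto simp: \<kappa>_def)
    then show ?thesis using CW q smooth_chart_inj_on[OF sW] by (metis inj_onD subsetD)
  qed
  ultimately have "C \<subseteq> \<Lambda>" using q WU by (intro maximal) auto
  then show ?thesis using point[OF z] CW that unfolding \<kappa>_def by auto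
qed

text \<open>
  By compactness of \<open>\<Lambda>\<close> the radius of such discs can be chosen uniformly, as a Lebesgue number. The lift
  \<open>x\<close> of the angles of \<open>p\<close> is arbitrary, since shifting by \<open>z\<close> commutes with reduction modulo \<open>2\<pi>\<close>.
\<close>

lemma uniform_slice_radius:
  obtains \<epsilon> where "\<epsilon> > 0"
    and "\<And>p x z. \<lbrakk>p \<in> \<Lambda>; \<theta> p = angle_point x; norm z < \<epsilon>\<rbrakk> \<Longrightarrow> \<exists>q\<in>\<Lambda>. \<theta> q = angle_point (x + z)"
proof -
  define P where "P \<epsilon> p \<longleftrightarrow>
    (\<forall>x z. \<theta> p = angle_point x \<longrightarrow> norm z < \<epsilon> \<longrightarrow> (\<exists>q\<in>\<Lambda>. \<theta> q = angle_point (x + z)))" for \<epsilon> p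
  define \<U> where "\<U> = {N. openin (carrier_top M) N \<and> (\<exists>\<epsilon>>0. \<forall>p\<in>N \<inter> \<Lambda>. P \<epsilon> p)}"
  have "\<exists>N\<in>\<U>. p \<in> N" if p: "p \<in> \<Lambda>" for p
  proof -
    obtain W \<theta>' where W: "canonical_chart W \<theta>'" "p \<in> W" using canonical_chart_at p subset by blast
    define \<kappa> where "\<kappa> = (\<lambda>q. (I q, \<theta>' q))"
    have sW: "smooth_chart M W \<kappa>" using W unfolding canonical_chart_def \<kappa>_def by auto
    have "open (\<kappa> ` W)" and oW: "openin (carrier_top M) W" using sW unfolding smooth_chart_def by auto
    then obtain e where e: "e > 0" "ball (\<kappa> p) e \<subseteq> \<kappa> ` W" using W(2) by (meson imageI openE)
    define N where "N = {q \<in> topspace (subtopology (carrier_top M) W). \<kappa> q \<in> ball (\<kappa> p) (e / 2)}"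
    have N_eq: "N = {q \<in> W. \<kappa> q \<in> ball (\<kappa> p) (e / 2)}"
      using openin_subset[OF oW] unfolding N_def by auto
    have "openin (subtopology (carrier_top M) W) N"
      unfolding N_def
      by (rule openin_continuous_map_preimage[OF smooth_chart_continuous_map[OF sW]]) simp
    then have "openin (carrier_top M) N" using openin_open_subtopology[OF oW] by blast
    moreover have "P (e / 2) q" if q: "q \<in> N \<inter> \<Lambda>" for q
      unfolding P_def
    proof (intro allI impI)
      fix x z assume x: "\<theta> q = angle_point x" and z: "norm (z :: real^2) < e / 2"
      have qW: "q \<in> W" "q \<in> \<Lambda>" "dist (\<kappa> p) (\<kappa> q) < e / 2" using q unfolding N_eq by auto
      have "ball (y, \<theta>' q) (e / 2) \<subseteq> ball (\<kappa> p) e"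
      proof
        fix w assume "w \<in> ball (y, \<theta>' q) (e / 2)"
        then have "dist (\<kappa> q) w < e / 2" using action[OF qW(2)] by (simp add: \<kappa>_def)
        then have "dist (\<kappa> p) w < e" using dist_triangle_half_l[of "\<kappa> p" "\<kappa> q" e w] qW(3)
          by (simp add: dist_commute)
        then show "w \<in> ball (\<kappa> p) e" by simp
      qed
      with e(2) have "ball (y, \<theta>' q) (e / 2) \<subseteq> (\<lambda>q. (I q, \<theta>' q)) ` W" unfolding \<kappa>_def by blast
      from slice_in_torus[OF W(1) qW(1,2) this z] obtain q' where q': "q' \<in> W" "q' \<in> \<Lambda>" "\<theta>' q' = \<theta>' q + z"
        by blast
      have ch: "\<theta> q = angle_point (\<theta>' q)" "\<theta> q' = angle_point (\<theta>' q')"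
        using W(1) qW(1) q'(1) unfolding canonical_chart_def by auto
      then have "angle_point (x + z) = angle_point (\<theta>' q + z)"
        using x by (intro angle_point_add_cong) simp
      then have "\<theta> q' = angle_point (x + z)" using ch(2) q'(3) by simp
      then show "\<exists>q\<in>\<Lambda>. \<theta> q = angle_point (x + z)" using q'(2) by blast
    qed
    ultimately have "N \<in> \<U>" unfolding \<U>_def using e(1) half_gt_zero by blast
    moreover have "p \<in> N" using W(2) e(1) unfolding N_eq by simp
    ultimately show ?thesis by blast
  qed
  then have "\<Lambda> \<subseteq> \<Union>\<U>" by blast
  moreover have "\<forall>N\<in>\<U>. openin (carrier_top M) N" unfolding \<U>_def by blast
  ultimately obtain \<F> where \<F>: "finite \<F>" "\<F> \<subseteq> \<U>" "\<Lambda> \<subseteq> \<Union>\<F>"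
    using compact unfolding compactin_def by meson
  from \<F>(1,2) have "\<exists>\<epsilon>>0. \<forall>N\<in>\<F>. \<forall>p\<in>N \<inter> \<Lambda>. P \<epsilon> p"
  proof (induction rule: finite_subset_induct)
    case empty
    show ?case using zero_less_one by blast
  next
    case (insert N F)
    then obtain d e where "d > 0" "e > 0" "\<forall>N\<in>F. \<forall>p\<in>N \<inter> \<Lambda>. P d p" "\<forall>p\<in>N \<inter> \<Lambda>. P e p"
      unfolding \<U>_def by blast
    moreover have "P (min d e) p" if "P d p \<or> P e p" for p
      using that unfolding P_def by auto
    ultimately show ?case by (intro exI[of _ "min d e"]) auto
  qed
  then obtain \<epsilon> where \<epsilon>: "\<epsilon> > 0" "\<forall>N\<in>\<F>. \<forall>p\<in>N \<inter> \<Lambda>. P \<epsilon> p" by blast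
  have "P \<epsilon> p" if "p \<in> \<Lambda>" for p using \<epsilon>(2) \<F>(3) that by blast
  then show ?thesis using that[OF \<epsilon>(1)] unfolding P_def by simp
qed

text \<open>
  Finitely many steps shorter than the uniform radius lead from the angles of one point of \<open>\<Lambda>\<close> to any
  point of the plane, so all angles are attained.
\<close>

lemma angles_surjective: "\<exists>p\<in>\<Lambda>. \<theta> p = angle_point x"
proof -
  obtain \<epsilon> where \<epsilon>: "\<epsilon> > 0"
    "\<And>p x z. \<lbrakk>p \<in> \<Lambda>; \<theta> p = angle_point x; norm z < \<epsilon>\<rbrakk> \<Longrightarrow> \<exists>q\<in>\<Lambda>. \<theta> q = angle_point (x + z)"
    using uniform_slice_radius by blast
  obtain p where p: "p \<in> \<Lambda>" using nonempty by blast
  obtain W \<theta>' where W: "canonical_chart W \<theta>'" "p \<in> W" using canonical_chart_at p subset by blast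
  define a where "a = \<theta>' p"
  have a: "\<theta> p = angle_point a" using W unfolding canonical_chart_def a_def by blast
  obtain n :: nat where n: "norm (x - a) / \<epsilon> < real n" using reals_Archimedean2 by blast
  have n0: "real n > 0" using n \<epsilon>(1) by (smt (verit) divide_nonneg_pos norm_ge_zero)
  define z where "z = (x - a) /\<^sub>R real n"
  have "norm z = norm (x - a) / real n"
    unfolding z_def by (simp only: norm_scaleR abs_inverse abs_of_nat divide_inverse mult.commute)
  also have "\<dots> < \<epsilon>" using n n0 \<epsilon>(1) by (simp add: divide_less_eq mult.commute)
  finally have z: "norm z < \<epsilon>" .
  have "\<exists>q\<in>\<Lambda>. \<theta> q = angle_point (a + real k *\<^sub>R z)" for k
  proof (induction k)
    case 0
    show ?case using p a by auto
  next
    case (Suc k)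
    then obtain q where "q \<in> \<Lambda>" "\<theta> q = angle_point (a + real k *\<^sub>R z)" by blast
    from \<epsilon>(2)[OF this z] show ?case by (simp add: algebra_simps)
  qed
  from this[of n] show ?thesis using n0 unfolding z_def by simp
qed

text \<open>Since \<open>(I, \<theta>)\<close> is injective, the angles parametrise \<open>\<Lambda>\<close>: this is the universal covering of the torus.\<close>

definition torus_point :: "real^2 \<Rightarrow> 'a" where
  "torus_point x = (THE p. p \<in> \<Lambda> \<and> \<theta> p = angle_point x)"

lemma torus_point_eqI:
  assumes "p \<in> U" "I p = y" "\<theta> p = angle_point x"
  shows "torus_point x = p" and "p \<in> \<Lambda>"
proof -
  obtain q where q: "q \<in> \<Lambda>" "\<theta> q = angle_point x" using angles_surjective by blast
  have eq: "r = p" if "r \<in> \<Lambda>" "\<theta> r = angle_point x" for r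
    using that assms subset action by (intro angle_eqI) auto
  then show "p \<in> \<Lambda>" using q by blast
  then show "torus_point x = p" unfolding torus_point_def using eq assms by blast
qed

lemma torus_point: "torus_point x \<in> \<Lambda>" "\<theta> (torus_point x) = angle_point x"
proof -
  obtain q where q: "q \<in> \<Lambda>" "\<theta> q = angle_point x" using angles_surjective by blast
  then have "torus_point x = q" using subset action by (intro torus_point_eqI) auto
  with q show "torus_point x \<in> \<Lambda>" "\<theta> (torus_point x) = angle_point x" by auto
qed

lemma torus_point_eq_iff: "torus_point x = torus_point x' \<longleftrightarrow> angle_point x = angle_point x'"
proof
  assume "torus_point x = torus_point x'"
  then show "angle_point x = angle_point x'" using torus_point(2)[of x] torus_point(2)[of x'] by simp
qed (simp add: torus_point_def)

lemma ex_torus_point: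
  assumes "p \<in> \<Lambda>"
  obtains x where "p = torus_point x"
proof -
  obtain W \<theta>' where W: "canonical_chart W \<theta>'" "p \<in> W" using canonical_chart_at assms subset by blast
  then have "\<theta> p = angle_point (\<theta>' p)" unfolding canonical_chart_def by blast
  then have "torus_point (\<theta>' p) = p" using assms subset action by (intro torus_point_eqI) auto
  then show ?thesis using that by metis
qed

lemma torus_point_in_chart:
  assumes W: "canonical_chart W \<theta>'" and x: "torus_point x \<in> W"
  obtains \<epsilon> where "\<epsilon> > 0"
    "\<And>z. norm z < \<epsilon> \<Longrightarrow> torus_point (x + z) \<in> W"
    "\<And>z. norm z < \<epsilon> \<Longrightarrow> \<theta>' (torus_point (x + z)) = \<theta>' (torus_point x) + z"
proof -
  define q where "q = torus_point x"
  have q: "q \<in> W" "q \<in> \<Lambda>" "\<theta> q = angle_point x" using x torus_point unfolding q_def by auto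
  have sW: "smooth_chart M W (\<lambda>q. (I q, \<theta>' q))" and WU: "W \<subseteq> U"
    and th: "\<And>q. q \<in> W \<Longrightarrow> \<theta> q = angle_point (\<theta>' q)"
    using W unfolding canonical_chart_def by auto
  then have "open ((\<lambda>q. (I q, \<theta>' q)) ` W)" unfolding smooth_chart_def by blast
  moreover have "(y, \<theta>' q) \<in> (\<lambda>q. (I q, \<theta>' q)) ` W" using q action[OF q(2)] by auto
  ultimately obtain \<epsilon> where \<epsilon>: "\<epsilon> > 0" "ball (y, \<theta>' q) \<epsilon> \<subseteq> (\<lambda>q. (I q, \<theta>' q)) ` W"
    by (rule openE)
  have "torus_point (x + z) \<in> W \<and> \<theta>' (torus_point (x + z)) = \<theta>' q + z" if z: "norm z < \<epsilon>" for z
  proof -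
    obtain q' where q': "q' \<in> W" "q' \<in> \<Lambda>" "\<theta>' q' = \<theta>' q + z"
      using slice_in_torus[OF W q(1,2) \<epsilon>(2) z] by blast
    have "angle_point (x + z) = angle_point (\<theta>' q + z)"
      using q th[of q] by (intro angle_point_add_cong) simp
    then have "\<theta> q' = angle_point (x + z)" using th[of q'] q' by simp
    then have "torus_point (x + z) = q'" using q' subset action by (intro torus_point_eqI) auto
    with q' show ?thesis by simp
  qed
  with that \<epsilon>(1) show ?thesis unfolding q_def by blast
qed

lemma continuous_map_torus_point: "continuous_map euclidean (carrier_top M) torus_point"
  unfolding continuous_map_def
proof (intro conjI allI impI)
  show "torus_point \<in> topspace euclidean \<rightarrow> points M"
    using torus_point(1) compactin_subset_topspace[OF compact] by blast
  fix N assume N: "openin (carrier_top M) N"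
  have "open {x. torus_point x \<in> N}"
    unfolding open_contains_ball
  proof
    fix x assume "x \<in> {x. torus_point x \<in> N}"
    then have xN: "torus_point x \<in> N" by simp
    obtain W \<theta>' where W: "canonical_chart W \<theta>'" "torus_point x \<in> W"
      using canonical_chart_at torus_point(1) subset by blast
    define \<kappa> where "\<kappa> = (\<lambda>q. (I q, \<theta>' q))"
    have sW: "smooth_chart M W \<kappa>" using W unfolding canonical_chart_def \<kappa>_def by auto
    have "open (\<kappa> ` (W \<inter> N))" by (rule smooth_chart_open_image[OF sW N])
    moreover have "\<kappa> (torus_point x) \<in> \<kappa> ` (W \<inter> N)" using xN W by blast
    ultimately obtain d where d: "d > 0" "ball (\<kappa> (torus_point x)) d \<subseteq> \<kappa> ` (W \<inter> N)" by (rule openE)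
    obtain e where e: "e > 0" "\<And>z. norm z < e \<Longrightarrow> torus_point (x + z) \<in> W"
      "\<And>z. norm z < e \<Longrightarrow> \<theta>' (torus_point (x + z)) = \<theta>' (torus_point x) + z"
      using torus_point_in_chart[OF W] by blast
    have "torus_point x' \<in> N" if x': "x' \<in> ball x (min d e)" for x'
    proof -
      define z where "z = x' - x"
      have z: "norm z < d" "norm z < e" "x' = x + z"
        using x' by (auto simp: z_def dist_norm norm_minus_commute)
      have "\<kappa> (torus_point x') = (y, \<theta>' (torus_point x) + z)"
        using e(3)[OF z(2)] action[OF torus_point(1)] by (simp add: \<kappa>_def z(3))
      also have "\<dots> \<in> ball (\<kappa> (torus_point x)) d"
        using z(1) action[OF torus_point(1)] by (simp add: \<kappa>_def dist_Pair_Pair dist_norm)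
      finally obtain q where "q \<in> W" "q \<in> N" "\<kappa> (torus_point x') = \<kappa> q" using d(2) by auto
      then show ?thesis
        using smooth_chart_inj_on[OF sW] e(2)[OF z(2)] z(3) by (metis inj_onD)
    qed
    then show "\<exists>e>0. ball x e \<subseteq> {x. torus_point x \<in> N}"
      using d(1) e(1) by (intro exI[of _ "min d e"]) auto
  qed
  then show "openin euclidean {x \<in> topspace euclidean. torus_point x \<in> N}" by simp
qed


section \<open>Flows of functions of the actions\<close>

lemma integral_curve_torus_point:
  assumes f: "\<And>p. p \<in> U \<Longrightarrow> f p = h (I p)" and h: "(h has_derivative (\<lambda>w. n \<bullet> w)) (at y)"
  shows "integral_curve M f (\<lambda>t. torus_point (a + t *\<^sub>R n))"
proof -
  define \<gamma> where "\<gamma> = (\<lambda>t. torus_point (a + t *\<^sub>R n))"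
  have "continuous_map euclideanreal euclidean (\<lambda>t. a + t *\<^sub>R n)"
    by (simp add: continuous_intros)
  from continuous_map_compose[OF this continuous_map_torus_point]
  have \<gamma>: "continuous_map euclideanreal (carrier_top M) \<gamma>" by (simp add: \<gamma>_def o_def)
  have "\<forall>c\<in>atlas M. \<gamma> t \<in> fst c \<longrightarrow>
          ((snd c \<circ> \<gamma>) has_vector_derivative hamiltonian_vector M c f (\<gamma> t)) (at t)" for t
  proof -
    have gL: "\<gamma> s \<in> \<Lambda>" for s unfolding \<gamma>_def by (rule torus_point(1))
    obtain W \<theta>' where W: "canonical_chart W \<theta>'" "\<gamma> t \<in> W"
      using canonical_chart_at gL subset by blast
    define \<kappa> where "\<kappa> = (\<lambda>q. (I q, \<theta>' q))"
    have sW: "smooth_chart M W \<kappa>" "form_expressed_by M W \<kappa> (\<lambda>_. standard_form)" "W \<subseteq> U"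
      using W unfolding canonical_chart_def \<kappa>_def by auto
    obtain e where e: "e > 0"
      "\<And>z. norm z < e \<Longrightarrow> \<theta>' (torus_point (a + t *\<^sub>R n + z)) = \<theta>' (\<gamma> t) + z"
      using torus_point_in_chart[OF W(1), of "a + t *\<^sub>R n"] W(2) unfolding \<gamma>_def by metis
    \<comment> \<open>The summand 1 covers the case \<open>n = 0\<close>.\<close>
    define \<delta> where "\<delta> = e / (norm n + 1)"
    have \<delta>: "\<delta> > 0" unfolding \<delta>_def using e(1) by (simp add: add_nonneg_pos)
    have line: "(y, \<theta>' (\<gamma> t) + (s - t) *\<^sub>R n) = (\<kappa> \<circ> \<gamma>) s" if s: "s \<in> ball t \<delta>" for s
    proof -
      have "\<bar>s - t\<bar> * (norm n + 1) < e"
        using s unfolding \<delta>_def by (simp add: dist_real_def abs_minus_commute pos_less_divide_eq add_nonneg_pos)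
      then have "norm ((s - t) *\<^sub>R n) < e"
        using mult_left_mono[of "norm n" "norm n + 1" "\<bar>s - t\<bar>"] by simp
      from e(2)[OF this] have "\<theta>' (\<gamma> s) = \<theta>' (\<gamma> t) + (s - t) *\<^sub>R n"
        by (simp add: \<gamma>_def algebra_simps)
      then show ?thesis using action[OF gL] by (simp add: \<kappa>_def)
    qed
    have "((\<lambda>s. (y, \<theta>' (\<gamma> t) + (s - t) *\<^sub>R n)) has_vector_derivative (0, n)) (at t)"
      by (auto intro!: derivative_eq_intros)
    then have "((\<kappa> \<circ> \<gamma>) has_vector_derivative (0, n)) (at t)"
      by (rule has_vector_derivative_transform_within_open[OF _ open_ball[of t \<delta>]]) (use \<delta> line in auto)
    moreover have "(h has_derivative (\<lambda>w. n \<bullet> w)) (at (fst (\<kappa> (\<gamma> t))))"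
      using h action[OF gL] by (simp add: \<kappa>_def)
    ultimately show ?thesis
      using integral_curve_action_angle[OF manifold sW(1,2), of f h n \<gamma> t] f sW(3) \<gamma> W(2)
      by (auto simp: \<kappa>_def)
  qed
  with \<gamma> show ?thesis unfolding integral_curve_def \<gamma>_def by blast
qed

text \<open>
  In a canonical chart any integral curve of \<open>h \<circ> I\<close> has constant actions and affine angles; hence the
  times at which it agrees with the linear curve on \<open>\<Lambda>\<close> form an open set, which is closed as \<open>M\<close> is
  Hausdorff. The differentiability of \<open>h\<close> is needed at all actions, because the actions are known to
  be constant only after the equation has been written in the chart.
\<close>

lemma integral_curve_unique:
  assumes f: "\<And>p. p \<in> U \<Longrightarrow> f p = h (I p)"
    and h: "\<And>x. x \<in> I ` U \<Longrightarrow> (h has_derivative (\<lambda>w. grad x \<bullet> w)) (at x)"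
    and \<gamma>: "integral_curve M f \<gamma>" "\<gamma> 0 = torus_point a"
  shows "\<gamma> t = torus_point (a + t *\<^sub>R grad y)"
proof -
  define n where "n = grad y"
  define \<eta> where "\<eta> = (\<lambda>t. torus_point (a + t *\<^sub>R n))"
  define S where "S = {t. \<gamma> t = \<eta> t}"
  have c\<gamma>: "continuous_map euclideanreal (carrier_top M) \<gamma>" using \<gamma>(1) unfolding integral_curve_def by blast
  have "continuous_map euclideanreal euclidean (\<lambda>t. a + t *\<^sub>R n)"
    by (simp add: continuous_intros)
  from continuous_map_compose[OF this continuous_map_torus_point]
  have "continuous_map euclideanreal (carrier_top M) \<eta>" by (simp add: \<eta>_def o_def)
  moreover have "Hausdorff_space (carrier_top M)" using manifold unfolding smooth_manifold_def by blast
  ultimately have "closed S"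
    using closedin_continuous_maps_eq[OF _ c\<gamma>] unfolding S_def by fastforce
  moreover have "open S"
    unfolding open_contains_ball
  proof
    fix t assume "t \<in> S"
    then have t: "\<gamma> t = \<eta> t" unfolding S_def by simp
    then have tL: "\<gamma> t \<in> \<Lambda>" "\<theta> (\<gamma> t) = angle_point (a + t *\<^sub>R n)"
      unfolding \<eta>_def by (simp_all add: torus_point)
    obtain W \<theta>' where W: "canonical_chart W \<theta>'" "\<gamma> t \<in> W"
      using canonical_chart_at tL subset by blast
    define \<kappa> where "\<kappa> = (\<lambda>q. (I q, \<theta>' q))"
    have sW: "smooth_chart M W \<kappa>" "form_expressed_by M W \<kappa> (\<lambda>_. standard_form)" "W \<subseteq> U"
      "\<And>q. q \<in> W \<Longrightarrow> \<theta> q = angle_point (\<theta>' q)"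
      using W unfolding canonical_chart_def \<kappa>_def by auto
    have "openin (carrier_top M) W" using sW(1) unfolding smooth_chart_def by blast
    from continuous_curve_stays[OF c\<gamma> this W(2)] obtain \<delta> where
      \<delta>: "\<delta> > 0" "\<And>s. s \<in> ball t \<delta> \<Longrightarrow> \<gamma> s \<in> W" by blast
    have vel: "((\<lambda>s. (I (\<gamma> s), \<theta>' (\<gamma> s))) has_vector_derivative (0, grad (I (\<gamma> s)))) (at s)"
      if s: "s \<in> ball t \<delta>" for s
    proof -
      have "(h has_derivative (\<lambda>w. grad (I (\<gamma> s)) \<bullet> w)) (at (fst (\<kappa> (\<gamma> s))))"
        using h \<delta>(2)[OF s] sW(3) by (auto simp: \<kappa>_def)
      then have "((\<kappa> \<circ> \<gamma>) has_vector_derivative (0, grad (I (\<gamma> s)))) (at s)"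
        using integral_curve_action_angle[OF manifold sW(1,2), of f h "grad (I (\<gamma> s))" \<gamma> s]
          f sW(3) c\<gamma> \<delta>(2)[OF s] \<gamma>(1) unfolding integral_curve_def by (auto simp: \<kappa>_def)
      then show ?thesis by (simp add: \<kappa>_def o_def)
    qed
    have tball: "t \<in> ball t \<delta>" using \<delta>(1) by simp
    have "((\<lambda>s. I (\<gamma> s)) has_derivative (\<lambda>_. 0)) (at s within ball t \<delta>)" if "s \<in> ball t \<delta>" for s
      using bounded_linear.has_vector_derivative[OF bounded_linear_fst vel[OF that]]
      by (simp add: has_vector_derivative_def has_derivative_at_withinI)
    from has_derivative_zero_unique[OF convex_ball this _ tball]
    have Iy: "I (\<gamma> s) = y" if "s \<in> ball t \<delta>" for s
      using that action[OF tL(1)] by simp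
    have "((\<lambda>s. \<theta>' (\<gamma> s) - s *\<^sub>R n) has_derivative (\<lambda>_. 0)) (at s within ball t \<delta>)"
      if "s \<in> ball t \<delta>" for s
    proof -
      have "((\<lambda>s. \<theta>' (\<gamma> s)) has_vector_derivative n) (at s)"
        using bounded_linear.has_vector_derivative[OF bounded_linear_snd vel[OF that]] Iy[OF that]
        by (simp add: n_def)
      then have "((\<lambda>s. \<theta>' (\<gamma> s) - s *\<^sub>R n) has_vector_derivative 0) (at s)"
        by (auto intro!: derivative_eq_intros)
      then show ?thesis by (simp add: has_vector_derivative_def has_derivative_at_withinI)
    qed
    from has_derivative_zero_unique[OF convex_ball this _ tball]
    have lin: "\<theta>' (\<gamma> s) - s *\<^sub>R n = \<theta>' (\<gamma> t) - t *\<^sub>R n" if "s \<in> ball t \<delta>" for s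
      using that by simp
    have "s \<in> S" if s: "s \<in> ball t \<delta>" for s
    proof -
      have "\<theta>' (\<gamma> s) = \<theta>' (\<gamma> t) + (s - t) *\<^sub>R n"
        using lin[OF s] by (simp add: algebra_simps)
      moreover have "angle_point (\<theta>' (\<gamma> t) + (s - t) *\<^sub>R n) = angle_point (a + t *\<^sub>R n + (s - t) *\<^sub>R n)"
        using tL(2) sW(4)[OF W(2)] by (intro angle_point_add_cong) simp
      moreover have "a + t *\<^sub>R n + (s - t) *\<^sub>R n = a + s *\<^sub>R n" by (simp add: algebra_simps)
      ultimately have "\<theta> (\<gamma> s) = angle_point (a + s *\<^sub>R n)"
        using sW(4)[OF \<delta>(2)[OF s]] by simp
      then have "\<eta> s = \<gamma> s"
        unfolding \<eta>_def using Iy[OF s] \<delta>(2)[OF s] sW(3) by (intro torus_point_eqI) auto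
      then show ?thesis unfolding S_def by simp
    qed
    then show "\<exists>e>0. ball t e \<subseteq> S" using \<delta>(1) by blast
  qed
  moreover have "0 \<in> S" using \<gamma>(2) unfolding S_def \<eta>_def by simp
  ultimately have "S = UNIV"
    using connected_UNIV[where ?'a = real] unfolding connected_clopen by fastforce
  then show ?thesis unfolding S_def \<eta>_def n_def by blast
qed

lemma ham_flow_torus_point:
  assumes f: "\<And>p. p \<in> U \<Longrightarrow> f p = h (I p)"
    and h: "\<And>x. x \<in> I ` U \<Longrightarrow> (h has_derivative (\<lambda>w. grad x \<bullet> w)) (at x)"
  shows "ham_flow M f t (torus_point a) = torus_point (a + t *\<^sub>R grad y)"
proof -
  have "y \<in> I ` U" using nonempty subset action by blast
  have "(THE \<gamma>. integral_curve M f \<gamma> \<and> \<gamma> 0 = torus_point a) = (\<lambda>t. torus_point (a + t *\<^sub>R grad y))"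
  proof (rule the_equality)
    show "integral_curve M f (\<lambda>t. torus_point (a + t *\<^sub>R grad y)) \<and>
        torus_point (a + 0 *\<^sub>R grad y) = torus_point a"
      using integral_curve_torus_point[OF f h[OF \<open>y \<in> I ` U\<close>]] by simp
  next
    fix \<gamma> assume "integral_curve M f \<gamma> \<and> \<gamma> 0 = torus_point a"
    then show "\<gamma> = (\<lambda>t. torus_point (a + t *\<^sub>R grad y))"
      using integral_curve_unique[OF f h] by blast
  qed
  then show ?thesis unfolding ham_flow_def by simp
qed

end


section \<open>The first return of the flow of the second integral\<close>

lemma first_return_time_unique:
  assumes "first_return_time M J H A T" "first_return_time M J H A T'"
  shows "T = T'"
  using assms unfolding first_return_time_def by (meson linorder_neqE_linordered_idom)

lemma mod_Z_eq_iff: "mod_Z x = mod_Z x' \<longleftrightarrow> [x = x'] (rmod 1)"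
  by (rule real_mod_Z.abs_eq_iff)

context action_angle_torus
begin

text \<open>
  The circle orbit of a point is the line of the first angle. The linear flow with velocity \<open>n\<close> returns
  to it when the second angle has turned once, and \<open>n\<^sub>1 / n\<^sub>2\<close> turns of the first angle have then been made.
\<close>

lemma semitoric_rotation_number_linear_flow:
  assumes J: "\<And>s x. ham_flow M J s (torus_point x) = torus_point (x + s *\<^sub>R axis 1 1)"
    and H: "\<And>t x. ham_flow M H t (torus_point x) = torus_point (x + t *\<^sub>R n)"
    and n: "n $ 2 > 0"
  shows "semitoric_rotation_number M J H \<Lambda> = mod_Z (n $ 1 / n $ 2)"
proof -
  define T where "T = 2 * pi / n $ 2"
  have cancel: "[b + a = b] (rmod (2 * pi)) \<longleftrightarrow> [a = 0] (rmod (2 * pi))" for a b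
    using rcong_add_left_cancel[where c = b and a = a and b = 0] by (simp only: add_0_right)
  have same: "torus_point (x + t *\<^sub>R n) = torus_point (x + s *\<^sub>R axis 1 1) \<longleftrightarrow>
      [t * n $ 1 = s] (rmod (2 * pi)) \<and> [t * n $ 2 = 0] (rmod (2 * pi))" for x s t
    by (simp add: torus_point_eq_iff angle_point_eq_iff axis_def cancel)
  have on_orbit: "ham_flow M H t (torus_point x) \<in> circle_orbit M J (torus_point x) \<longleftrightarrow>
      [t * n $ 2 = 0] (rmod (2 * pi))" for x t
    unfolding circle_orbit_def H J using same by blast
  have return: "first_return_time M J H (torus_point x) T" for x
    unfolding first_return_time_def on_orbit
  proof (intro conjI allI impI)
    show "T > 0" using n unfolding T_def by simp
    have "T * n $ 2 = of_int 1 * (2 * pi)" using n unfolding T_def by simp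
    then show "[T * n $ 2 = 0] (rmod (2 * pi))" using rcong_mult_of_int_0_left_right by metis
    fix t assume "0 < t \<and> t < T"
    then have t: "0 < t * n $ 2" "t * n $ 2 < 2 * pi"
      using n unfolding T_def by (auto simp: pos_less_divide_eq)
    show "\<not> [t * n $ 2 = 0] (rmod (2 * pi))"
    proof
      assume "[t * n $ 2 = 0] (rmod (2 * pi))"
      from rcong_imp_eq[OF this] t show False by auto
    qed
  qed
  have rotation: "torus_point (x + (2 * pi * w) *\<^sub>R axis 1 1) = torus_point (x + T *\<^sub>R n) \<longleftrightarrow>
      mod_Z w = mod_Z (n $ 1 / n $ 2)" for x w
  proof -
    have "[T * n $ 2 = 0] (rmod (2 * pi))" using return on_orbit unfolding first_return_time_def by blast
    then have "torus_point (x + (2 * pi * w) *\<^sub>R axis 1 1) = torus_point (x + T *\<^sub>R n) \<longleftrightarrow>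
        [T * n $ 1 = 2 * pi * w] (rmod (2 * pi))"
      using same[of x T "2 * pi * w"] by metis
    also have "\<dots> \<longleftrightarrow> (\<exists>k::int. 2 * pi * w = 2 * pi * (n $ 1 / n $ 2 + of_int k))"
      unfolding rcong_altdef T_def by (simp add: algebra_simps)
    also have "\<dots> \<longleftrightarrow> [n $ 1 / n $ 2 = w] (rmod 1)"
      unfolding rcong_altdef by simp
    finally show ?thesis by (simp add: mod_Z_eq_iff rcong_sym_iff)
  qed
  show ?thesis
    unfolding semitoric_rotation_number_def
  proof (rule the_equality)
    show "\<forall>A\<in>\<Lambda>. \<exists>T w. first_return_time M J H A T \<and> mod_Z (n $ 1 / n $ 2) = mod_Z w \<and>
        ham_flow M J (2 * pi * w) A = ham_flow M H T A"
    proof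
      fix A assume "A \<in> \<Lambda>"
      then obtain x where x: "A = torus_point x" by (rule ex_torus_point)
      show "\<exists>T w. first_return_time M J H A T \<and> mod_Z (n $ 1 / n $ 2) = mod_Z w \<and>
          ham_flow M J (2 * pi * w) A = ham_flow M H T A"
        using return rotation unfolding x H J by blast
    qed
  next
    fix r assume r: "\<forall>A\<in>\<Lambda>. \<exists>T w. first_return_time M J H A T \<and> r = mod_Z w \<and>
        ham_flow M J (2 * pi * w) A = ham_flow M H T A"
    obtain T' w where "first_return_time M J H (torus_point 0) T'" "r = mod_Z w"
      "ham_flow M J (2 * pi * w) (torus_point 0) = ham_flow M H T' (torus_point 0)"
      using r torus_point(1) by blast
    then show "r = mod_Z (n $ 1 / n $ 2)"
      using first_return_time_unique[OF return] rotation unfolding H J by metis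
  qed
qed

end


section \<open>Liouville tori with semitoric action variables\<close>

text \<open>
  A locally injective \<open>G\<close> with \<open>G \<circ> I\<close> constant forces \<open>I\<close> to be locally constant, hence constant by
  connectedness.
\<close>

lemma action_constant_on_connected:
  fixes I :: "'a \<Rightarrow> 'e::euclidean_space" and G :: "'e \<Rightarrow> 'f::euclidean_space"
  assumes conn: "connectedin X L" and nonempty: "L \<noteq> {}"
    and I: "\<And>p. p \<in> L \<Longrightarrow> \<exists>W. openin X W \<and> p \<in> W \<and> continuous_map (subtopology X W) euclidean I"
    and D: "I ` L \<subseteq> D" and G: "local_diffeo_on D G"
    and const: "\<And>p. p \<in> L \<Longrightarrow> G (I p) = c"
  obtains y where "\<And>p. p \<in> L \<Longrightarrow> I p = y"
proof -
  obtain p\<^sub>0 where p\<^sub>0: "p\<^sub>0 \<in> L" using nonempty by blast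
  have LX: "L \<subseteq> topspace X" using conn connectedin_subset_topspace by blast
  have nbhd: "\<exists>N. openin X N \<and> p \<in> N \<and> (\<forall>q\<in>N \<inter> L. I q = I p)" if p: "p \<in> L" for p
  proof -
    obtain V where V: "I p \<in> V" "V \<subseteq> D" "diffeo_on V G"
      using G D p unfolding local_diffeo_on_def by (meson image_subset_iff)
    obtain W where W: "openin X W" "p \<in> W" "continuous_map (subtopology X W) euclidean I"
      using I[OF p] by blast
    define N where "N = {q \<in> topspace (subtopology X W). I q \<in> V}"
    have "open V" using V unfolding diffeo_on_def by blast
    then have "openin (subtopology X W) N"
      unfolding N_def by (intro openin_continuous_map_preimage[OF W(3)]) simp
    then have "openin X N" using openin_open_subtopology[OF W(1)] by blast
    moreover have "p \<in> N" using p LX W V unfolding N_def by auto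
    moreover have "I q = I p" if q: "q \<in> N" "q \<in> L" for q
    proof -
      have "inj_on G V" using V unfolding diffeo_on_def by blast
      moreover have "I q \<in> V" using q unfolding N_def by blast
      moreover have "G (I q) = G (I p)" using const p q by simp
      ultimately show ?thesis using V(1) by (meson inj_onD)
    qed
    ultimately show ?thesis by blast
  qed
  have op: "openin (subtopology X L) {q \<in> L. P (I q)}" for P
  proof (subst openin_subopen, intro ballI)
    fix p assume p: "p \<in> {q \<in> L. P (I q)}"
    then obtain N where N: "openin X N" "p \<in> N" "\<forall>q\<in>N \<inter> L. I q = I p" using nbhd by blast
    then have "openin (subtopology X L) (N \<inter> L)" by (simp add: openin_subtopology_Int)
    moreover have "p \<in> N \<inter> L" using N(2) p by blast
    moreover have "N \<inter> L \<subseteq> {q \<in> L. P (I q)}"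
    proof
      fix q assume q: "q \<in> N \<inter> L"
      then have "I q = I p" using N(3) by blast
      with p q show "q \<in> {q \<in> L. P (I q)}" by simp
    qed
    ultimately show "\<exists>N. openin (subtopology X L) N \<and> p \<in> N \<and> N \<subseteq> {q \<in> L. P (I q)}" by blast
  qed
  define E where "E = {q \<in> L. I q = I p\<^sub>0}"
  have ts: "topspace (subtopology X L) = L" using LX by auto
  have "L - E = {q \<in> L. I q \<noteq> I p\<^sub>0}" unfolding E_def by blast
  then have "closedin (subtopology X L) E"
    using op[of "\<lambda>v. v \<noteq> I p\<^sub>0"] unfolding closedin_def ts E_def by auto
  moreover have "openin (subtopology X L) E" using op[of "\<lambda>v. v = I p\<^sub>0"] unfolding E_def .
  moreover have "connected_space (subtopology X L)" using conn unfolding connectedin_def by blast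
  ultimately have "E = {} \<or> E = L" using connected_space_clopen_in ts by metis
  moreover have "p\<^sub>0 \<in> E" using p\<^sub>0 unfolding E_def by blast
  ultimately show ?thesis using that[of "I p\<^sub>0"] unfolding E_def by blast
qed

text \<open>Differentiability of \<open>g\<close> at an action value can be read off from \<open>G\<close>, with which it is only known to
  agree on \<open>I ` U\<close>, because this set is open.\<close>

lemma symplectic_angle_coordinates_open_actions:
  assumes "symplectic_angle_coordinates M U I \<theta>"
  shows "open (I ` U)"
  unfolding open_subopen[of "I ` U"]
proof
  fix x assume "x \<in> I ` U"
  then obtain p where p: "p \<in> U" "x = I p" by blast
  obtain W \<theta>' where W: "p \<in> W" "W \<subseteq> U" "\<forall>q\<in>W. \<theta> q = angle_point (\<theta>' q)"
      "smooth_chart M W (\<lambda>q. (I q, \<theta>' q))"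
      "form_expressed_by M W (\<lambda>q. (I q, \<theta>' q)) (\<lambda>_. standard_form)"
    by (rule symplectic_angle_coordinates_chart[OF assms p(1)])
  have "open (fst ` (\<lambda>q. (I q, \<theta>' q)) ` W)"
    using W(4) unfolding smooth_chart_def by (intro open_image_fst) blast
  then have "open (I ` W)" by (simp add: image_image)
  then show "\<exists>T. open T \<and> x \<in> T \<and> T \<subseteq> I ` U" using W p by blast
qed

lemma symplectic_angle_coordinates_continuous_action:
  assumes "symplectic_angle_coordinates M U I \<theta>" "p \<in> U"
  shows "\<exists>W. openin (carrier_top M) W \<and> p \<in> W \<and> continuous_map (subtopology (carrier_top M) W) euclidean I"
proof -
  obtain W \<theta>' where W: "p \<in> W" "W \<subseteq> U" "\<forall>q\<in>W. \<theta> q = angle_point (\<theta>' q)"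
      "smooth_chart M W (\<lambda>q. (I q, \<theta>' q))"
      "form_expressed_by M W (\<lambda>q. (I q, \<theta>' q)) (\<lambda>_. standard_form)"
    by (rule symplectic_angle_coordinates_chart[OF assms])
  have "continuous_map euclidean euclidean (fst :: (real^2) \<times> (real^2) \<Rightarrow> real^2)"
    by (simp add: continuous_on_fst)
  from continuous_map_compose[OF smooth_chart_continuous_map[OF W(4)] this]
  have "continuous_map (subtopology (carrier_top M) W) euclidean I" by (simp add: o_def)
  then show ?thesis using W unfolding smooth_chart_def by blast
qed

text \<open>
  A connected part of the level set \<open>I = y\<close> lies in a fibre of \<open>F = G(I)\<close>, so \<open>\<Lambda>\<close>, a component of that
  fibre, inherits maximality; properness of \<open>F\<close> makes it compact.
\<close>

lemma liouville_torus_action_angle: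
  assumes M: "smooth_manifold M" and proper: "proper_map (carrier_top M) euclidean (joint_map J H)"
    and L: "liouville_torus M J H \<Lambda>" and av: "action_variables M J H \<Lambda> U I \<theta> G"
  obtains y where "action_angle_torus M U I \<theta> \<Lambda> y"
proof -
  obtain c where c: "\<Lambda> \<in> connected_components_of (subtopology (carrier_top M) (fibre M J H c))"
    using L unfolding liouville_torus_def by blast
  have LU: "\<Lambda> \<subseteq> U" and co: "symplectic_angle_coordinates M U I \<theta>" and G: "local_diffeo_on (I ` U) G"
    and GI: "\<And>p. p \<in> U \<Longrightarrow> joint_map J H p = G (I p)"
    using av unfolding action_variables_def by auto
  have UM: "U \<subseteq> points M" using co openin_subset unfolding symplectic_angle_coordinates_def by blast
  have conn: "connectedin (carrier_top M) \<Lambda>" and LF: "\<Lambda> \<subseteq> fibre M J H c"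
    using connectedin_connected_components_of[OF c] by (auto simp: connectedin_subtopology)
  have ne: "\<Lambda> \<noteq> {}" by (rule nonempty_connected_components_of[OF c])
  have F: "joint_map J H p = c" if "p \<in> \<Lambda>" for p using LF that unfolding fibre_def by blast
  have "compactin (carrier_top M) (fibre M J H c)"
    using proper unfolding proper_map_def fibre_def by simp
  then have "compactin (carrier_top M) \<Lambda>"
    using closedin_connected_components_of[OF c] LF
    by (meson closed_compactin compactin_subtopology closedin_compact_space compact_space_subtopology)
  obtain y where y: "\<And>p. p \<in> \<Lambda> \<Longrightarrow> I p = y"
    using action_constant_on_connected[OF conn ne _ _ G, of I c]
      symplectic_angle_coordinates_continuous_action[OF co] LU F GI by (metis image_mono subsetD)
  have Gy: "G y = c" using ne y F GI LU by (metis all_not_in_conv subsetD)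
  have "action_angle_torus M U I \<theta> \<Lambda> y"
  proof
    fix S assume S: "connectedin (carrier_top M) S" "S \<subseteq> U" "\<And>p. p \<in> S \<Longrightarrow> I p = y" "S \<inter> \<Lambda> \<noteq> {}"
    have "S \<subseteq> fibre M J H c" using S UM GI Gy unfolding fibre_def by auto
    then have "connectedin (subtopology (carrier_top M) (fibre M J H c)) S"
      using S(1) by (simp add: connectedin_subtopology)
    then show "S \<subseteq> \<Lambda>" using connected_components_of_maximal[OF c] S(4) by (auto simp: disjnt_def)
  qed fact+
  then show ?thesis by (rule that)
qed

text \<open>
  As \<open>G = (I\<^sub>1, g)\<close>, the matrix of \<open>dG\<close> has first row \<open>(1, 0)\<close> and determinant \<open>\<partial>\<^sub>2 g\<close>, so that
  orientation makes \<open>\<partial>\<^sub>2 g\<close> positive.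
\<close>

lemma semitoric_action_variables_gradient:
  assumes sav: "semitoric_action_variables M J H \<Lambda> U I \<theta> G"
    and g: "\<And>p. p \<in> U \<Longrightarrow> H p = g (I p)" and x: "x \<in> I ` U"
  shows "(g has_derivative (\<lambda>w. vector [partial 1 g x, partial 2 g x] \<bullet> w)) (at x)"
    and "partial 2 g x > 0"
proof -
  have G: "local_diffeo_on (I ` U) G" and co: "symplectic_angle_coordinates M U I \<theta>"
    and GI: "\<And>p. p \<in> U \<Longrightarrow> joint_map J H p = G (I p)"
    and det: "det (matrix (frechet_derivative G (at x))) > 0"
    and IJ: "\<And>p. p \<in> U \<Longrightarrow> I p $ 1 = J p"
    using sav x unfolding semitoric_action_variables_def oriented_action_variables_def action_variables_def
    by blast+
  define D where "D = frechet_derivative G (at x)"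
  obtain V where "x \<in> V" "smooth_on V G" using G x unfolding local_diffeo_on_def diffeo_on_def by meson
  then have D: "(G has_derivative D) (at x)"
    unfolding D_def using smooth_on_imp_differentiable by (simp add: frechet_derivative_works[symmetric])
  have op: "open (I ` U)" by (rule symplectic_angle_coordinates_open_actions[OF co])
  have G1: "G z $ 1 = z $ 1" and G2: "G z $ 2 = g z" if "z \<in> I ` U" for z
    using that GI IJ g by (auto simp: joint_map_def GI[symmetric])
  have comp: "((\<lambda>z. G z $ k) has_derivative (\<lambda>w. D w $ k)) (at x)" for k
    by (rule bounded_linear.has_derivative[OF bounded_linear_vec_nth D])
  have "((\<lambda>z. z $ 1) has_derivative (\<lambda>w. D w $ 1)) (at x)"
    by (rule has_derivative_transform_within_open[OF comp[of 1] op x]) (rule G1)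
  then have D1: "D w $ 1 = w $ 1" for w
    using has_derivative_unique bounded_linear_imp_has_derivative[OF bounded_linear_vec_nth] by metis
  have gD: "(g has_derivative (\<lambda>w. D w $ 2)) (at x)"
    by (rule has_derivative_transform_within_open[OF comp[of 2] op x]) (rule G2)
  have part: "partial k g x = D (axis k 1) $ 2" for k
    unfolding partial_def by (simp add: frechet_derivative_at[OF gD, symmetric])
  interpret D: bounded_linear D using D by (rule has_derivative_bounded_linear)
  have "D w $ 2 = vector [partial 1 g x, partial 2 g x] \<bullet> w" for w
  proof -
    have "w = w $ 1 *\<^sub>R axis 1 1 + w $ 2 *\<^sub>R axis 2 1"
      by (simp add: vec_eq_iff forall_2 axis_def)
    then have "D w $ 2 = (D (w $ 1 *\<^sub>R axis 1 1 + w $ 2 *\<^sub>R axis 2 1)) $ 2" by metis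
    then show ?thesis by (simp add: D.add D.scaleR part inner_vec_def sum_2)
  qed
  with gD show "(g has_derivative (\<lambda>w. vector [partial 1 g x, partial 2 g x] \<bullet> w)) (at x)" by simp
  show "partial 2 g x > 0"
    using det unfolding D_def[symmetric] by (simp add: det_2 matrix_def D1 part axis_def)
qed

theorem proposition2p10:
  fixes M :: "'a manifold_with_form"
    and J H :: "'a \<Rightarrow> real"
    and \<Lambda> U :: "'a set"
    and I :: "'a \<Rightarrow> real^2"
    and \<theta> :: "'a \<Rightarrow> angle^2"
    and G :: "real^2 \<Rightarrow> real^2"
    and g :: "real^2 \<Rightarrow> real"
  assumes "symplectic_manifold M"
    and "semitoric_system M J H"
    and "liouville_torus M J H \<Lambda>"
    and "semitoric_action_variables M J H \<Lambda> U I \<theta> G"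
    and "\<And>p. p \<in> U \<Longrightarrow> H p = g (I p)"
  shows "semitoric_rotation_number M J H \<Lambda> = mod_Z (rotation_ratio I g \<Lambda>)"
proof -
  have av: "action_variables M J H \<Lambda> U I \<theta> G" and IJ: "\<And>p. p \<in> U \<Longrightarrow> J p = I p $ 1"
    using assms(4) unfolding semitoric_action_variables_def oriented_action_variables_def by auto
  obtain y where "action_angle_torus M U I \<theta> \<Lambda> y"
    using liouville_torus_action_angle[OF _ _ assms(3) av] assms(1,2)
    unfolding symplectic_manifold_def semitoric_system_def by blast
  then interpret action_angle_torus M U I \<theta> \<Lambda> y .
  note grad = semitoric_action_variables_gradient[OF assms(4,5)]
  define n where "n = (\<lambda>x. vector [partial 1 g x, partial 2 g x] :: real^2)"
  have flow_J: "ham_flow M J s (torus_point x) = torus_point (x + s *\<^sub>R axis 1 1)" for s x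
  proof (rule ham_flow_torus_point[where h = "\<lambda>v. v $ 1" and grad = "\<lambda>_. axis 1 1", OF IJ])
    show "((\<lambda>v. v $ 1) has_derivative (\<lambda>w. axis 1 1 \<bullet> w)) (at z)" for z :: "real^2"
      using bounded_linear_imp_has_derivative[OF bounded_linear_vec_nth]
      by (simp add: inner_axis')
  qed
  have flow_H: "ham_flow M H t (torus_point x) = torus_point (x + t *\<^sub>R n y)" for t x
    by (rule ham_flow_torus_point[where h = g and grad = n, OF assms(5)]) (simp_all add: n_def grad(1))
  have "y \<in> I ` U" using nonempty subset action by blast
  then have "n y $ 2 > 0" using grad(2) by (simp add: n_def)
  from semitoric_rotation_number_linear_flow[OF flow_J flow_H this]
  have "semitoric_rotation_number M J H \<Lambda> = mod_Z (partial 1 g y / partial 2 g y)" by (simp add: n_def)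
  moreover have "I ` \<Lambda> = {y}" using nonempty action by auto
  ultimately show ?thesis unfolding rotation_ratio_def by simp
qed

end
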